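(* Let $(A,1,\Delta,\varepsilon)$ be a comonoidal weak bialgebra and let $T\in\mathrm{End}_K(A_R)$. Then $T$ is an endomorphism of the right $A$-comodule $(A_R,\Delta|_{A_R})$, i.e. $\Delta(T(a))=(T\otimes\mathrm{id})(\Delta(a))$ for all $a\in A_R$, if and only if there exists $z\in A_L\cap A_R$ such that $T(a)=az=za$ for all $a\in A_R$.
   Context: $K$ is a field and all spaces are finite dimensional over $K$. A weak bialgebra $(A,1,\Delta,\varepsilon)$ is a unital associative $K$-algebra $(A,1)$ which is also a coassociative coalgebra with coproduct $\Delta$ and counit $\varepsilon$, such that $\Delta(ab)=\Delta(a)\Delta(b)$ for all $a,b$; neither $\Delta(1)=1\otimes1$ nor multiplicativity of $\varepsilon$ is required. Sweedler notation is used. $A$ is comonoidal if $(\Delta(1)\otimes1)(1\otimes\Delta(1))=1_{(1)}\otimes1_{(2)}\otimes1_{(3)}=(1\otimes\Delta(1))(\Delta(1)\otimes1)$. With $\hat A=\mathrm{Hom}_K(A,K)$, $A_L=\{\langle\phi\mid1_{(1)}\rangle1_{(2)}:\phi\in\hat A\}$ and $A_R=\{1_{(1)}\langle\phi\mid1_{(2)}\rangle:\phi\in\hat A\}$. In a comonoidal weak bialgebra these are commuting unital subalgebras of $A$, and $\Delta(A_R)\subset A_R\otimes A$, so $\Delta|_{A_R}:A_R\to A_R\otimes A$ makes $A_R$ a right $A$-comodule. *)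

theory Defs
  imports Complex_Main "HOL-Library.Function_Algebras"
begin

section \<open>Tensor powers of a vector space\<close>

text \<open>
  The base field is a type \<open>'k::field\<close>, and \<open>s :: 'k \<Rightarrow> 'a \<Rightarrow> 'a\<close> is the scalar multiplication of
  a vector space \<open>A\<close> with underlying type \<open>'a\<close>.  The tensor product \<open>A \<otimes> A\<close> is realised inside the
  space of functionals on bilinear forms: the pure tensor \<open>x \<otimes> y\<close> is evaluation of bilinear forms
  at \<open>(x, y)\<close>, and \<open>A \<otimes> A\<close> consists of the finite sums of pure tensors.  Arguments that
  are not bilinear forms are sent to \<open>0\<close>, so that equality of tensors is equality of functions.
  Likewise for \<open>A \<otimes> A \<otimes> A\<close>, with trilinear forms.  Addition is pointwise.
\<close>

type_synonym ('k, 'a) tensor2 = "('a \<Rightarrow> 'a \<Rightarrow> 'k) \<Rightarrow> 'k"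
type_synonym ('k, 'a) tensor3 = "('a \<Rightarrow> 'a \<Rightarrow> 'a \<Rightarrow> 'k) \<Rightarrow> 'k"

definition linear_form :: "('k::field \<Rightarrow> 'a::ab_group_add \<Rightarrow> 'a) \<Rightarrow> ('a \<Rightarrow> 'k) \<Rightarrow> bool" where
  "linear_form s \<phi> \<longleftrightarrow> Vector_Spaces.linear s (*) \<phi>"

definition bilinear_form :: "('k::field \<Rightarrow> 'a::ab_group_add \<Rightarrow> 'a) \<Rightarrow> ('a \<Rightarrow> 'a \<Rightarrow> 'k) \<Rightarrow> bool" where
  "bilinear_form s w \<longleftrightarrow>
     (\<forall>y. linear_form s (\<lambda>x. w x y)) \<and> (\<forall>x. linear_form s (\<lambda>y. w x y))"

definition trilinear_form ::
    "('k::field \<Rightarrow> 'a::ab_group_add \<Rightarrow> 'a) \<Rightarrow> ('a \<Rightarrow> 'a \<Rightarrow> 'a \<Rightarrow> 'k) \<Rightarrow> bool" where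
  "trilinear_form s w \<longleftrightarrow>
     (\<forall>y z. linear_form s (\<lambda>x. w x y z)) \<and>
     (\<forall>x z. linear_form s (\<lambda>y. w x y z)) \<and>
     (\<forall>x y. linear_form s (\<lambda>z. w x y z))"

definition tens2 :: "('k::field \<Rightarrow> 'a::ab_group_add \<Rightarrow> 'a) \<Rightarrow> 'a \<Rightarrow> 'a \<Rightarrow> ('k, 'a) tensor2" where
  "tens2 s x y = (\<lambda>w. if bilinear_form s w then w x y else 0)"

definition tens3 :: "('k::field \<Rightarrow> 'a::ab_group_add \<Rightarrow> 'a) \<Rightarrow> 'a \<Rightarrow> 'a \<Rightarrow> 'a \<Rightarrow> ('k, 'a) tensor3" where
  "tens3 s x y z = (\<lambda>w. if trilinear_form s w then w x y z else 0)"

definition tensor_space2 :: "('k::field \<Rightarrow> 'a::ab_group_add \<Rightarrow> 'a) \<Rightarrow> ('k, 'a) tensor2 set" where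
  "tensor_space2 s = {t. \<exists>ps. t = (\<Sum>(x, y)\<leftarrow>ps. tens2 s x y)}"

definition tensor_scale :: "'k::field \<Rightarrow> ('w \<Rightarrow> 'k) \<Rightarrow> 'w \<Rightarrow> 'k" where
  "tensor_scale c t = (\<lambda>w. c * t w)"

text \<open>
  \<open>lift2_on s U f t\<close> is the value at \<open>t \<in> U \<otimes> A \<subseteq> A \<otimes> A\<close> of the linear map induced by the
  bilinear map \<open>f\<close> on \<open>U \<times> A\<close>, for a subspace \<open>U\<close> of \<open>A\<close>; in Sweedler notation it is
  \<open>f t\<^sub>1 t\<^sub>2\<close>.  Values of \<open>f\<close> off \<open>U \<times> A\<close> are irrelevant.  That the value does not depend on
  the decomposition of \<open>t\<close> is \<open>lift2_on_sum\<close> (and \<open>lift3_sum\<close> for \<open>A \<otimes> A \<otimes> A\<close>) below.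
\<close>

definition lift2_on :: "('k::field \<Rightarrow> 'a::ab_group_add \<Rightarrow> 'a) \<Rightarrow> 'a set \<Rightarrow>
    ('a \<Rightarrow> 'a \<Rightarrow> 'v::ab_group_add) \<Rightarrow> ('k, 'a) tensor2 \<Rightarrow> 'v" where
  "lift2_on s U f t = (THE v. \<exists>ps. set ps \<subseteq> U \<times> UNIV \<and>
     t = (\<Sum>(x, y)\<leftarrow>ps. tens2 s x y) \<and> v = (\<Sum>(x, y)\<leftarrow>ps. f x y))"

abbreviation lift2 :: "('k::field \<Rightarrow> 'a::ab_group_add \<Rightarrow> 'a) \<Rightarrow>
    ('a \<Rightarrow> 'a \<Rightarrow> 'v::ab_group_add) \<Rightarrow> ('k, 'a) tensor2 \<Rightarrow> 'v" where
  "lift2 s \<equiv> lift2_on s UNIV"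

definition lift3 :: "('k::field \<Rightarrow> 'a::ab_group_add \<Rightarrow> 'a) \<Rightarrow>
    ('a \<Rightarrow> 'a \<Rightarrow> 'a \<Rightarrow> 'v::ab_group_add) \<Rightarrow> ('k, 'a) tensor3 \<Rightarrow> 'v" where
  "lift3 s f t = (THE v. \<exists>ps.
     t = (\<Sum>(x, y, z)\<leftarrow>ps. tens3 s x y z) \<and> v = (\<Sum>(x, y, z)\<leftarrow>ps. f x y z))"

definition mult2 :: "('k::field \<Rightarrow> 'a::ring \<Rightarrow> 'a) \<Rightarrow>
    ('k, 'a) tensor2 \<Rightarrow> ('k, 'a) tensor2 \<Rightarrow> ('k, 'a) tensor2" where
  "mult2 s t u = lift2 s (\<lambda>a b. lift2 s (\<lambda>a' b'. tens2 s (a * a') (b * b')) u) t"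

definition mult3 :: "('k::field \<Rightarrow> 'a::ring \<Rightarrow> 'a) \<Rightarrow>
    ('k, 'a) tensor3 \<Rightarrow> ('k, 'a) tensor3 \<Rightarrow> ('k, 'a) tensor3" where
  "mult3 s t u =
     lift3 s (\<lambda>a b c. lift3 s (\<lambda>a' b' c'. tens3 s (a * a') (b * b') (c * c')) u) t"

definition append_tens :: "('k::field \<Rightarrow> 'a::ab_group_add \<Rightarrow> 'a) \<Rightarrow>
    ('k, 'a) tensor2 \<Rightarrow> 'a \<Rightarrow> ('k, 'a) tensor3" where
  "append_tens s t z = lift2 s (\<lambda>x y. tens3 s x y z) t"

definition prepend_tens :: "('k::field \<Rightarrow> 'a::ab_group_add \<Rightarrow> 'a) \<Rightarrow>
    'a \<Rightarrow> ('k, 'a) tensor2 \<Rightarrow> ('k, 'a) tensor3" where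
  "prepend_tens s x t = lift2 s (\<lambda>y z. tens3 s x y z) t"


section \<open>Weak bialgebras\<close>

text \<open>
  The sort \<open>{ring, monoid_mult}\<close> is that of unital associative rings in which \<open>0 = 1\<close> is allowed.
\<close>

locale weak_bialgebra = vector_space scale
  for scale :: "'k::field \<Rightarrow> 'a::{ring, monoid_mult} \<Rightarrow> 'a" +
  fixes \<Delta> :: "'a \<Rightarrow> ('k, 'a) tensor2"
    and \<epsilon> :: "'a \<Rightarrow> 'k"
  assumes finite_dim: "\<exists>B. finite B \<and> span B = UNIV"
    and scale_mult_left: "scale c x * y = scale c (x * y)"
    and scale_mult_right: "x * scale c y = scale c (x * y)"
    and comult_in_tensor_space: "\<Delta> x \<in> tensor_space2 scale"
    and comult_linear: "Vector_Spaces.linear scale tensor_scale \<Delta>"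
    and counit_linear: "linear_form scale \<epsilon>"
    and coassoc: "lift2 scale (\<lambda>y z. append_tens scale (\<Delta> y) z) (\<Delta> x) =
                  lift2 scale (\<lambda>y z. prepend_tens scale y (\<Delta> z)) (\<Delta> x)"
    and counit_left: "lift2 scale (\<lambda>y z. scale (\<epsilon> y) z) (\<Delta> x) = x"
    and counit_right: "lift2 scale (\<lambda>y z. scale (\<epsilon> z) y) (\<Delta> x) = x"
    and comult_mult: "\<Delta> (x * y) = mult2 scale (\<Delta> x) (\<Delta> y)"

text \<open>In the next locale \<open>1\<^sub>1 \<otimes> 1\<^sub>2 \<otimes> 1\<^sub>3\<close> is written as \<open>(\<Delta> \<otimes> id) (\<Delta> 1)\<close>.\<close>

locale comonoidal_weak_bialgebra = weak_bialgebra +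
  assumes comonoidal_left:
      "mult3 scale (append_tens scale (\<Delta> 1) 1) (prepend_tens scale 1 (\<Delta> 1)) =
       lift2 scale (\<lambda>y z. append_tens scale (\<Delta> y) z) (\<Delta> 1)"
    and comonoidal_right:
      "mult3 scale (prepend_tens scale 1 (\<Delta> 1)) (append_tens scale (\<Delta> 1) 1) =
       lift2 scale (\<lambda>y z. append_tens scale (\<Delta> y) z) (\<Delta> 1)"

definition A_L :: "('k::field \<Rightarrow> 'a::{ring, monoid_mult} \<Rightarrow> 'a) \<Rightarrow>
    ('a \<Rightarrow> ('k, 'a) tensor2) \<Rightarrow> 'a set" where
  "A_L s \<Delta> = {lift2 s (\<lambda>x y. s (\<phi> x) y) (\<Delta> 1) | \<phi>. linear_form s \<phi>}"

definition A_R :: "('k::field \<Rightarrow> 'a::{ring, monoid_mult} \<Rightarrow> 'a) \<Rightarrow>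
    ('a \<Rightarrow> ('k, 'a) tensor2) \<Rightarrow> 'a set" where
  "A_R s \<Delta> = {lift2 s (\<lambda>x y. s (\<phi> y) x) (\<Delta> 1) | \<phi>. linear_form s \<phi>}"

text \<open>\<open>T\<close> is a total function, but only its values on the subspace \<open>U\<close> matter.\<close>

definition endomorphism_on :: "('k::field \<Rightarrow> 'a::ab_group_add \<Rightarrow> 'a) \<Rightarrow> 'a set \<Rightarrow> ('a \<Rightarrow> 'a) \<Rightarrow> bool" where
  "endomorphism_on s U T \<longleftrightarrow>
     (\<forall>x\<in>U. T x \<in> U) \<and>
     (\<forall>x\<in>U. \<forall>y\<in>U. T (x + y) = T x + T y) \<and>
     (\<forall>c. \<forall>x\<in>U. T (s c x) = s c (T x))"

text \<open>\<open>T \<otimes> id\<close> on \<open>U \<otimes> A\<close>, for \<open>T\<close> linear on the subspace \<open>U\<close>.\<close>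

definition map_first_on :: "('k::field \<Rightarrow> 'a::ab_group_add \<Rightarrow> 'a) \<Rightarrow> 'a set \<Rightarrow> ('a \<Rightarrow> 'a) \<Rightarrow>
    ('k, 'a) tensor2 \<Rightarrow> ('k, 'a) tensor2" where
  "map_first_on s U T t = lift2_on s U (\<lambda>x y. tens2 s (T x) y) t"


section \<open>Well-definedness of the induced maps\<close>

lemma vector_space_mult: "vector_space ((*) :: 'k::field \<Rightarrow> 'k \<Rightarrow> 'k)"
  by unfold_locales (auto simp: algebra_simps)

lemma vector_space_tensor_scale: "vector_space (tensor_scale :: 'k::field \<Rightarrow> ('w \<Rightarrow> 'k) \<Rightarrow> 'w \<Rightarrow> 'k)"
  by unfold_locales (auto simp: tensor_scale_def fun_eq_iff algebra_simps)

lemma linear_form_iff: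
  "linear_form s \<phi> \<longleftrightarrow>
     vector_space s \<and> (\<forall>x y. \<phi> (x + y) = \<phi> x + \<phi> y) \<and> (\<forall>c x. \<phi> (s c x) = c * \<phi> x)"
  by (simp add: linear_form_def Vector_Spaces.linear_iff vector_space_mult)

lemma exists_separating_form:
  fixes s :: "'k::field \<Rightarrow> 'v::ab_group_add \<Rightarrow> 'v"
  assumes "vector_space s" and "v \<noteq> 0"
  obtains \<xi> where "linear_form s \<xi>" and "\<xi> v \<noteq> 0"
proof -
  interpret p: vector_space_pair s "(*) :: 'k \<Rightarrow> 'k \<Rightarrow> 'k"
    using assms(1) vector_space_mult by (simp add: vector_space_pair_def)
  have "p.vs1.independent {v}" using assms(2) by simp
  from p.linear_independent_extend[OF this, of "\<lambda>_. 1"]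
  obtain \<xi> where "Vector_Spaces.linear s (*) \<xi>" "\<xi> v = 1" by auto
  then show thesis using that by (auto simp: linear_form_def)
qed

lemma exists_projection:
  assumes "vector_space s" and "module.subspace s U"
  obtains p where "Vector_Spaces.linear s s p" and "range p \<subseteq> U" and "\<And>x. x \<in> U \<Longrightarrow> p x = x"
proof -
  interpret p: vector_space_pair s s
    using assms(1) by (simp add: vector_space_pair_def)
  have "Vector_Spaces.linear s s (\<lambda>x. x)"
    by (simp add: Vector_Spaces.linear_iff assms(1))
  from p.linear_exists_left_inverse_on[OF this assms(2)] show thesis
    using that by auto
qed

lemma additive_sum_list:
  fixes \<phi> :: "'v::ab_group_add \<Rightarrow> 'w::ab_group_add"
  assumes "\<And>x y. \<phi> (x + y) = \<phi> x + \<phi> y"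
  shows "\<phi> (sum_list xs) = (\<Sum>x\<leftarrow>xs. \<phi> x)"
proof (induction xs)
  case Nil
  show ?case using assms[of 0 0] by simp
qed (simp add: assms)

lemma sum_tens2_apply:
  assumes "bilinear_form s w"
  shows "(\<Sum>(x, y)\<leftarrow>ps. tens2 s x y) w = (\<Sum>(x, y)\<leftarrow>ps. w x y)"
  by (induction ps) (auto simp: tens2_def assms)

lemma sum_tens3_apply:
  assumes "trilinear_form s w"
  shows "(\<Sum>(x, y, z)\<leftarrow>ps. tens3 s x y z) w = (\<Sum>(x, y, z)\<leftarrow>ps. w x y z)"
  by (induction ps) (auto simp: tens3_def assms)

lemma lift2_on_sum:
  assumes s: "vector_space s" and s': "vector_space s'" and U: "module.subspace s U"
    and add1: "\<And>x x' y. x \<in> U \<Longrightarrow> x' \<in> U \<Longrightarrow> f (x + x') y = f x y + f x' y"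
    and scale1: "\<And>c x y. x \<in> U \<Longrightarrow> f (s c x) y = s' c (f x y)"
    and add2: "\<And>x y y'. x \<in> U \<Longrightarrow> f x (y + y') = f x y + f x y'"
    and scale2: "\<And>c x y. x \<in> U \<Longrightarrow> f x (s c y) = s' c (f x y)"
    and ps: "set ps \<subseteq> U \<times> UNIV"
  shows "lift2_on s U f (\<Sum>(x, y)\<leftarrow>ps. tens2 s x y) = (\<Sum>(x, y)\<leftarrow>ps. f x y)"
proof -
  obtain p where p: "Vector_Spaces.linear s s p" "range p \<subseteq> U" "\<And>x. x \<in> U \<Longrightarrow> p x = x"
    using exists_projection[OF s U] by blast
  have pU: "p x \<in> U" for x using p(2) by auto
  have eq: "(\<Sum>(x, y)\<leftarrow>qs. f x y) = (\<Sum>(x, y)\<leftarrow>ps. f x y)"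
    if qs: "set qs \<subseteq> U \<times> UNIV"
      and t: "(\<Sum>(x, y)\<leftarrow>ps. tens2 s x y) = (\<Sum>(x, y)\<leftarrow>qs. tens2 s x y)" for qs
  proof (rule ccontr)
    let ?F = "\<lambda>ps. \<Sum>(x, y)\<leftarrow>ps. f x y"
    assume "?F qs \<noteq> ?F ps"
    then obtain \<xi> where \<xi>: "linear_form s' \<xi>" "\<xi> (?F qs - ?F ps) \<noteq> 0"
      using exists_separating_form[OF s', of "?F qs - ?F ps"] by auto
    note \<xi>' = \<xi>(1)[unfolded linear_form_iff]
    define w where "w = (\<lambda>x y. \<xi> (f (p x) y))"
    have w: "bilinear_form s w"
      unfolding bilinear_form_def linear_form_iff w_def
      using p(1) pU \<xi>' s by (simp add: Vector_Spaces.linear_iff add1 scale1 add2 scale2)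
    have "\<xi> (?F rs) = (\<Sum>(x, y)\<leftarrow>rs. tens2 s x y) w" if "set rs \<subseteq> U \<times> UNIV" for rs
    proof -
      have "\<xi> (?F rs) = (\<Sum>(x, y)\<leftarrow>rs. \<xi> (f x y))"
        using \<xi>' additive_sum_list[of \<xi> "map (\<lambda>(x, y). f x y) rs"]
        by (simp add: o_def case_prod_unfold)
      also have "\<dots> = (\<Sum>(x, y)\<leftarrow>rs. w x y)"
        using that by (intro arg_cong[where f = sum_list] map_cong) (auto simp: w_def p(3))
      finally show ?thesis by (simp add: sum_tens2_apply[OF w])
    qed
    then have "\<xi> (?F qs) = \<xi> (?F ps)" using qs ps t by simp
    moreover have "\<xi> (?F qs) = \<xi> (?F qs - ?F ps) + \<xi> (?F ps)"
      using \<xi>' by (metis diff_add_cancel)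
    ultimately show False using \<xi>(2) by simp
  qed
  show ?thesis
    unfolding lift2_on_def
  proof (rule the_equality, goal_cases)
    case 1
    show ?case using ps by blast
  next
    case (2 v)
    then show ?case using eq by blast
  qed
qed

lemma lift3_sum:
  assumes s: "vector_space s" and s': "vector_space s'"
    and add: "\<And>x x' y z. f (x + x') y z = f x y z + f x' y z"
      "\<And>x y y' z. f x (y + y') z = f x y z + f x y' z"
      "\<And>x y z z'. f x y (z + z') = f x y z + f x y z'"
    and scale: "\<And>c x y z. f (s c x) y z = s' c (f x y z)"
      "\<And>c x y z. f x (s c y) z = s' c (f x y z)"
      "\<And>c x y z. f x y (s c z) = s' c (f x y z)"
  shows "lift3 s f (\<Sum>(x, y, z)\<leftarrow>ps. tens3 s x y z) = (\<Sum>(x, y, z)\<leftarrow>ps. f x y z)"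
proof -
  have eq: "(\<Sum>(x, y, z)\<leftarrow>qs. f x y z) = (\<Sum>(x, y, z)\<leftarrow>ps. f x y z)"
    if t: "(\<Sum>(x, y, z)\<leftarrow>ps. tens3 s x y z) = (\<Sum>(x, y, z)\<leftarrow>qs. tens3 s x y z)" for qs
  proof (rule ccontr)
    let ?F = "\<lambda>ps. \<Sum>(x, y, z)\<leftarrow>ps. f x y z"
    assume "?F qs \<noteq> ?F ps"
    then obtain \<xi> where \<xi>: "linear_form s' \<xi>" "\<xi> (?F qs - ?F ps) \<noteq> 0"
      using exists_separating_form[OF s', of "?F qs - ?F ps"] by auto
    note \<xi>' = \<xi>(1)[unfolded linear_form_iff]
    define w where "w = (\<lambda>x y z. \<xi> (f x y z))"
    have w: "trilinear_form s w"
      unfolding trilinear_form_def linear_form_iff w_def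
      using \<xi>' s by (simp add: add scale)
    have "\<xi> (?F rs) = (\<Sum>(x, y, z)\<leftarrow>rs. tens3 s x y z) w" for rs
    proof -
      have "\<xi> (?F rs) = (\<Sum>(x, y, z)\<leftarrow>rs. w x y z)"
        using \<xi>' additive_sum_list[of \<xi> "map (\<lambda>(x, y, z). f x y z) rs"]
        by (simp add: o_def case_prod_unfold w_def)
      then show ?thesis by (simp add: sum_tens3_apply[OF w])
    qed
    then have "\<xi> (?F qs) = \<xi> (?F ps)" using t by simp
    moreover have "\<xi> (?F qs) = \<xi> (?F qs - ?F ps) + \<xi> (?F ps)"
      using \<xi>' by (metis diff_add_cancel)
    ultimately show False using \<xi>(2) by simp
  qed
  show ?thesis
    unfolding lift3_def
  proof (rule the_equality, goal_cases)
    case 1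
    show ?case by blast
  next
    case (2 v)
    then show ?case using eq by blast
  qed
qed

end

theory Submission
  imports Defs
begin

text \<open>
  Comonoidality gives \<open>\<Delta>(a) = 1\<^sub>1 \<otimes> 1\<^sub>2a = 1\<^sub>1 \<otimes> a1\<^sub>2\<close> for \<open>a \<in> A\<^sub>R\<close> and, together with
  coassociativity, \<open>\<Delta>(z) = z1\<^sub>1 \<otimes> 1\<^sub>2\<close> for \<open>z \<in> A\<^sub>L\<close>.  If \<open>T\<close> is a comodule endomorphism, put
  \<open>z = T(1)\<close>; then \<open>\<Delta>(z) = T(1\<^sub>1) \<otimes> 1\<^sub>2\<close>, hence
  \<open>\<Delta>(T(a)) = T(1\<^sub>1) \<otimes> 1\<^sub>2a = \<Delta>(z)(1 \<otimes> a)\<close>, and likewise \<open>\<Delta>(T(a)) = (1 \<otimes> a)\<Delta>(z)\<close>.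
  Applying \<open>\<epsilon> \<otimes> id\<close> yields \<open>T(a) = za = az\<close>;
  in particular \<open>z = \<epsilon>(T(1\<^sub>1))1\<^sub>2 = \<epsilon>(z1\<^sub>1)1\<^sub>2 \<in> A\<^sub>L\<close>.  Conversely,
  \<open>\<Delta>(za) = (z \<otimes> 1)\<Delta>(1)\<Delta>(a) = (z \<otimes> 1)\<Delta>(a)\<close>.
\<close>

section \<open>Multilinear maps and separation by linear forms\<close>

definition tensor_space3 :: "('k::field \<Rightarrow> 'a::ab_group_add \<Rightarrow> 'a) \<Rightarrow> ('k, 'a) tensor3 set" where
  "tensor_space3 s = {t. \<exists>ps. t = (\<Sum>(x, y, z)\<leftarrow>ps. tens3 s x y z)}"

text \<open>The target has its own scalar multiplication \<open>s'\<close>, so one notion covers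
  scalar-valued forms, maps into \<open>A\<close>, and tensor-valued maps with
  \<open>s' = tensor_scale\<close>.\<close>

definition bilinear_map ::
    "('k \<Rightarrow> 'a::ab_group_add \<Rightarrow> 'a) \<Rightarrow> ('k \<Rightarrow> 'v::ab_group_add \<Rightarrow> 'v) \<Rightarrow> ('a \<Rightarrow> 'a \<Rightarrow> 'v) \<Rightarrow> bool" where
  "bilinear_map s s' f \<longleftrightarrow>
     (\<forall>x x' y. f (x + x') y = f x y + f x' y) \<and> (\<forall>c x y. f (s c x) y = s' c (f x y)) \<and>
     (\<forall>x y y'. f x (y + y') = f x y + f x y') \<and> (\<forall>c x y. f x (s c y) = s' c (f x y))"

text \<open>Fixing the last and fixing the first argument together cover linearity in all three, and
  both slices are then available as bilinear maps.\<close>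

definition trilinear_map ::
    "('k \<Rightarrow> 'a::ab_group_add \<Rightarrow> 'a) \<Rightarrow> ('k \<Rightarrow> 'v::ab_group_add \<Rightarrow> 'v) \<Rightarrow> ('a \<Rightarrow> 'a \<Rightarrow> 'a \<Rightarrow> 'v) \<Rightarrow> bool" where
  "trilinear_map s s' f \<longleftrightarrow>
     (\<forall>z. bilinear_map s s' (\<lambda>x y. f x y z)) \<and> (\<forall>x. bilinear_map s s' (f x))"

text \<open>A nonzero difference would be detected by some linear form. Equations in
  \<open>A\<close> can therefore be tested under all linear forms, which turns them into scalar
  equations between evaluations of tensors.\<close>

lemma linear_form_separation:
  assumes "vector_space s" and "\<And>\<xi>. linear_form s \<xi> \<Longrightarrow> \<xi> u = \<xi> v"
  shows "u = v"
proof (rule ccontr)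
  assume "u \<noteq> v"
  then obtain \<xi> where \<xi>: "linear_form s \<xi>" "\<xi> (u - v) \<noteq> 0"
    using exists_separating_form[OF assms(1), of "u - v"] by auto
  have "\<xi> u = \<xi> (u - v) + \<xi> v"
    using \<xi>(1) by (metis linear_form_iff diff_add_cancel)
  with \<xi>(2) assms(2)[OF \<xi>(1)] show False by simp
qed

lemma linear_form_0:
  "linear_form s \<xi> \<Longrightarrow> \<xi> 0 = 0"
  by (metis linear_form_iff add_cancel_right_right)

lemma linear_form_sum_list:
  assumes "linear_form s \<xi>"
  shows "\<xi> (sum_list vs) = (\<Sum>v\<leftarrow>vs. \<xi> v)"
  using assms additive_sum_list[of \<xi>] by (simp add: linear_form_iff)

lemma linear_form_sum:
  assumes "linear_form s \<xi>"
  shows "\<xi> (sum f A) = (\<Sum>a\<in>A. \<xi> (f a))"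
  using assms linear_form_0[OF assms]
  by (induction A rule: infinite_finite_induct) (auto simp: linear_form_iff)

text \<open>Tensors are added and scaled pointwise, so evaluation at any fixed \<open>w\<close>,
  multilinear or not, is linear. It serves as the form \<xi> whenever the values of a lift are
  themselves tensors.\<close>

lemma linear_form_tensor_apply: "linear_form tensor_scale (\<lambda>t. t w)"
  by (simp add: linear_form_iff vector_space_tensor_scale tensor_scale_def)

lemma bilinear_form_iff:
  "bilinear_form s w \<longleftrightarrow> vector_space s \<and> bilinear_map s (*) w"
  by (auto simp: bilinear_form_def linear_form_iff bilinear_map_def)

lemma trilinear_form_iff:
  "trilinear_form s w \<longleftrightarrow> vector_space s \<and> trilinear_map s (*) w"
  by (auto simp: trilinear_form_def linear_form_iff trilinear_map_def bilinear_map_def)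

section \<open>Tensors as functionals on multilinear forms\<close>

lemma tensor_space2_apply:
  assumes "t \<in> tensor_space2 s"
  obtains ps where "t = (\<Sum>(x, y)\<leftarrow>ps. tens2 s x y)"
    and "\<And>w. bilinear_form s w \<Longrightarrow> t w = (\<Sum>(x, y)\<leftarrow>ps. w x y)"
  using assms sum_tens2_apply unfolding tensor_space2_def by blast

lemma tensor_space3_apply:
  assumes "t \<in> tensor_space3 s"
  obtains ps where "t = (\<Sum>(x, y, z)\<leftarrow>ps. tens3 s x y z)"
    and "\<And>w. trilinear_form s w \<Longrightarrow> t w = (\<Sum>(x, y, z)\<leftarrow>ps. w x y z)"
  using assms sum_tens3_apply unfolding tensor_space3_def by blast

lemma sum_tens2_nonbilinear:
  assumes "\<not> bilinear_form s w"
  shows "(\<Sum>(x, y)\<leftarrow>ps. tens2 s x y) w = 0"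
  by (induction ps) (auto simp: tens2_def assms)

text \<open>Away from bilinear forms both tensors take the default value \<open>0\<close>, so
  agreement on bilinear forms is agreement everywhere.\<close>

lemma tensor2_eqI:
  assumes "t \<in> tensor_space2 s" and "u \<in> tensor_space2 s"
    and "\<And>w. bilinear_form s w \<Longrightarrow> t w = u w"
  shows "t = u"
proof
  fix w
  show "t w = u w"
    using assms sum_tens2_nonbilinear[of s w] unfolding tensor_space2_def
    by (cases "bilinear_form s w") auto
qed

text \<open>A finite sum of evaluations is additive in the form. Bilinearity of both summands
  matters: the default value \<open>0\<close> on other functions breaks additivity in
  general.\<close>

lemma tensor2_add:
  assumes "t \<in> tensor_space2 s" and v: "bilinear_form s v" and w: "bilinear_form s w"
  shows "t (\<lambda>x y. v x y + w x y) = t v + t w"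
proof -
  obtain ps where ps: "\<And>w. bilinear_form s w \<Longrightarrow> t w = (\<Sum>(x, y)\<leftarrow>ps. w x y)"
    using assms(1) by (rule tensor_space2_apply) blast
  have "bilinear_form s (\<lambda>x y. v x y + w x y)"
    using v w by (simp add: bilinear_form_iff bilinear_map_def algebra_simps)
  then show ?thesis
    by (simp add: ps v w sum_list_addf case_prod_unfold)
qed

lemma tensor2_scale:
  assumes "t \<in> tensor_space2 s" and w: "bilinear_form s w"
  shows "t (\<lambda>x y. c * w x y) = c * t w"
proof -
  obtain ps where ps: "\<And>w. bilinear_form s w \<Longrightarrow> t w = (\<Sum>(x, y)\<leftarrow>ps. w x y)"
    using assms(1) by (rule tensor_space2_apply) blast
  have "bilinear_form s (\<lambda>x y. c * w x y)"
    using w by (simp add: bilinear_form_iff bilinear_map_def algebra_simps)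
  then show ?thesis
    by (simp add: ps w sum_list_const_mult case_prod_unfold)
qed

lemma tensor2_sum:
  assumes t: "t \<in> tensor_space2 s" and s: "vector_space s"
    and w: "\<And>i. i \<in> I \<Longrightarrow> bilinear_form s (w i)"
  shows "t (\<lambda>x y. \<Sum>i\<in>I. w i x y) = (\<Sum>i\<in>I. t (w i))"
proof -
  obtain ps where ps: "\<And>w. bilinear_form s w \<Longrightarrow> t w = (\<Sum>(x, y)\<leftarrow>ps. w x y)"
    using t by (rule tensor_space2_apply) blast
  have "bilinear_form s (\<lambda>x y. \<Sum>i\<in>I. w i x y)"
    using w s by (simp add: bilinear_form_iff bilinear_map_def sum.distrib sum_distrib_left)
  moreover have "(\<Sum>(x, y)\<leftarrow>ps. \<Sum>i\<in>I. w i x y) = (\<Sum>i\<in>I. \<Sum>(x, y)\<leftarrow>ps. w i x y)"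
    by (induction ps) (auto simp: sum.distrib)
  ultimately show ?thesis
    using w by (simp add: ps)
qed

text \<open>
  Turns identities in Sweedler notation into identities between iterated functionals: a
  linear form applied to \<open>f t\<^sub>1 t\<^sub>2\<close> is \<open>t\<close> evaluated at a bilinear form.
\<close>

lemma lift2_eval:
  assumes s: "vector_space s" and t: "t \<in> tensor_space2 s" and f: "bilinear_map s s' f"
    and \<xi>: "linear_form s' \<xi>"
  shows "\<xi> (lift2 s f t) = t (\<lambda>x y. \<xi> (f x y))"
proof -
  interpret vector_space s by (rule s)
  obtain ps where ps: "t = (\<Sum>(x, y)\<leftarrow>ps. tens2 s x y)"
    "\<And>w. bilinear_form s w \<Longrightarrow> t w = (\<Sum>(x, y)\<leftarrow>ps. w x y)"
    using t by (rule tensor_space2_apply) blast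
  have w: "bilinear_form s (\<lambda>x y. \<xi> (f x y))"
    using f \<xi> s by (simp add: bilinear_form_iff bilinear_map_def linear_form_iff)
  have "lift2 s f t = (\<Sum>(x, y)\<leftarrow>ps. f x y)"
    unfolding ps(1) using f \<xi>
    by (intro lift2_on_sum[OF s, of s']) (auto simp: bilinear_map_def linear_form_iff)
  then show ?thesis
    by (simp add: linear_form_sum_list[OF \<xi>] ps(2)[OF w] o_def case_prod_unfold)
qed

text \<open>With this, nested lifts of tensor-valued maps unfold into nested evaluations;
  \<open>w\<close> is arbitrary because evaluation is linear at every argument.\<close>

lemma lift2_apply:
  assumes "vector_space s" and "t \<in> tensor_space2 s" and "bilinear_map s tensor_scale f"
  shows "lift2 s f t w = t (\<lambda>x y. f x y w)"
  using lift2_eval[OF assms linear_form_tensor_apply[of w]] .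

lemma lift3_apply:
  assumes s: "vector_space s" and t: "t \<in> tensor_space3 s" and f: "trilinear_map s tensor_scale f"
  shows "lift3 s f t w = t (\<lambda>x y z. f x y z w)"
proof -
  obtain ps where ps: "t = (\<Sum>(x, y, z)\<leftarrow>ps. tens3 s x y z)"
    "\<And>w. trilinear_form s w \<Longrightarrow> t w = (\<Sum>(x, y, z)\<leftarrow>ps. w x y z)"
    using t by (rule tensor_space3_apply) blast
  have w: "trilinear_form s (\<lambda>x y z. f x y z w)"
    using f s by (simp add: trilinear_form_iff trilinear_map_def bilinear_map_def tensor_scale_def)
  have "lift3 s f t = (\<Sum>(x, y, z)\<leftarrow>ps. f x y z)"
    unfolding ps(1) using f
    by (intro lift3_sum[OF s vector_space_tensor_scale])
      (auto simp: trilinear_map_def bilinear_map_def)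
  then show ?thesis
    using linear_form_sum_list[OF linear_form_tensor_apply[of w],
        of "map (\<lambda>(x, y, z). f x y z) ps"]
    by (simp add: ps(2)[OF w] o_def case_prod_unfold)
qed

lemma bilinear_map_tens2:
  "bilinear_map s tensor_scale (tens2 s)"
  by (auto simp: bilinear_map_def tens2_def tensor_scale_def bilinear_form_iff fun_eq_iff)

lemma trilinear_map_tens3:
  "trilinear_map s tensor_scale (tens3 s)"
  by (auto simp: trilinear_map_def bilinear_map_def tens3_def tensor_scale_def trilinear_form_iff
      fun_eq_iff)

lemma tensor3_add:
  assumes "t \<in> tensor_space3 s" and v: "trilinear_form s v" and w: "trilinear_form s w"
  shows "t (\<lambda>x y z. v x y z + w x y z) = t v + t w"
proof -
  obtain ps where ps: "\<And>w. trilinear_form s w \<Longrightarrow> t w = (\<Sum>(x, y, z)\<leftarrow>ps. w x y z)"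
    using assms(1) by (rule tensor_space3_apply) blast
  have "trilinear_form s (\<lambda>x y z. v x y z + w x y z)"
    using v w by (simp add: trilinear_form_iff trilinear_map_def bilinear_map_def algebra_simps)
  then show ?thesis
    by (simp add: ps v w sum_list_addf case_prod_unfold)
qed

lemma tensor3_scale:
  assumes "t \<in> tensor_space3 s" and w: "trilinear_form s w"
  shows "t (\<lambda>x y z. c * w x y z) = c * t w"
proof -
  obtain ps where ps: "\<And>w. trilinear_form s w \<Longrightarrow> t w = (\<Sum>(x, y, z)\<leftarrow>ps. w x y z)"
    using assms(1) by (rule tensor_space3_apply) blast
  have "trilinear_form s (\<lambda>x y z. c * w x y z)"
    using w by (simp add: trilinear_form_iff trilinear_map_def bilinear_map_def algebra_simps)
  then show ?thesis
    by (simp add: ps w sum_list_const_mult case_prod_unfold)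
qed

text \<open>Linear dependence of a form on a parameter \<open>b\<close> passes through
  \<open>t\<close>, since \<open>t\<close> is linear on bilinear forms. This is how an iterated
  evaluation is seen to be multilinear again, one variable at a time.\<close>

lemma linear_form_tensor2:
  assumes t: "t \<in> tensor_space2 s" and s: "vector_space s"
    and lin: "\<And>x y. linear_form s (\<lambda>b. w b x y)" and bil: "\<And>b. bilinear_form s (w b)"
  shows "linear_form s (\<lambda>b. t (w b))"
proof -
  have "w (a + b) = (\<lambda>x y. w a x y + w b x y)" "w (s c b) = (\<lambda>x y. c * w b x y)" for a b c
    using lin by (auto simp: linear_form_iff fun_eq_iff)
  with s show ?thesis
    by (simp add: linear_form_iff tensor2_add[OF t bil bil] tensor2_scale[OF t bil])
qed

lemma linear_form_tensor3:
  assumes t: "t \<in> tensor_space3 s" and s: "vector_space s"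
    and lin: "\<And>x y z. linear_form s (\<lambda>b. w b x y z)" and tri: "\<And>b. trilinear_form s (w b)"
  shows "linear_form s (\<lambda>b. t (w b))"
proof -
  have "w (a + b) = (\<lambda>x y z. w a x y z + w b x y z)" "w (s c b) = (\<lambda>x y z. c * w b x y z)"
    for a b c
    using lin by (auto simp: linear_form_iff fun_eq_iff)
  with s show ?thesis
    by (simp add: linear_form_iff tensor3_add[OF t tri tri] tensor3_scale[OF t tri])
qed

text \<open>Operations on tensors are pointwise, so bilinearity can be checked at each argument
  \<open>w\<close> separately, including those \<open>w\<close> that are not multilinear.\<close>

lemma bilinear_map_tensorI:
  assumes "\<And>w. bilinear_form s (\<lambda>x y. f x y w)"
  shows "bilinear_map s tensor_scale f"
  using assms by (simp add: bilinear_form_iff bilinear_map_def fun_eq_iff tensor_scale_def)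

lemma trilinear_map_tensorI:
  assumes "\<And>w. trilinear_form s (\<lambda>x y z. f x y z w)"
  shows "trilinear_map s tensor_scale f"
  using assms
  by (simp add: trilinear_form_iff trilinear_map_def bilinear_map_def fun_eq_iff tensor_scale_def)

section \<open>Adjoining a third tensor factor\<close>

lemma append_tens_in_tensor_space3:
  assumes s: "vector_space s" and t: "t \<in> tensor_space2 s"
  shows "append_tens s t z \<in> tensor_space3 s"
proof -
  interpret vector_space s by (rule s)
  obtain ps where ps: "t = (\<Sum>(x, y)\<leftarrow>ps. tens2 s x y)"
    using t by (rule tensor_space2_apply) blast
  have "append_tens s t z = (\<Sum>(x, y)\<leftarrow>ps. tens3 s x y z)"
    unfolding append_tens_def ps(1) using trilinear_map_tens3[of s]
    by (intro lift2_on_sum[OF s vector_space_tensor_scale])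
      (auto simp: bilinear_map_def trilinear_map_def)
  also have "\<dots> = (\<Sum>(x, y, z)\<leftarrow>map (\<lambda>(x, y). (x, y, z)) ps. tens3 s x y z)"
    by (simp add: o_def case_prod_unfold)
  finally show ?thesis unfolding tensor_space3_def by blast
qed

lemma prepend_tens_in_tensor_space3:
  assumes s: "vector_space s" and t: "t \<in> tensor_space2 s"
  shows "prepend_tens s x t \<in> tensor_space3 s"
proof -
  interpret vector_space s by (rule s)
  obtain ps where ps: "t = (\<Sum>(x, y)\<leftarrow>ps. tens2 s x y)"
    using t by (rule tensor_space2_apply) blast
  have "prepend_tens s x t = (\<Sum>(y, z)\<leftarrow>ps. tens3 s x y z)"
    unfolding prepend_tens_def ps(1) using trilinear_map_tens3[of s]
    by (intro lift2_on_sum[OF s vector_space_tensor_scale])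
      (auto simp: bilinear_map_def trilinear_map_def)
  also have "\<dots> = (\<Sum>(x, y, z)\<leftarrow>map (\<lambda>(y, z). (x, y, z)) ps. tens3 s x y z)"
    by (simp add: o_def case_prod_unfold)
  finally show ?thesis unfolding tensor_space3_def by blast
qed

lemma append_tens_apply:
  assumes "vector_space s" and "t \<in> tensor_space2 s" and "trilinear_form s w"
  shows "append_tens s t z w = t (\<lambda>x y. w x y z)"
  unfolding append_tens_def using assms trilinear_map_tens3[of s]
  by (subst lift2_apply) (auto simp: trilinear_map_def tens3_def)

lemma prepend_tens_apply:
  assumes "vector_space s" and "t \<in> tensor_space2 s" and "trilinear_form s w"
  shows "prepend_tens s x t w = t (\<lambda>y z. w x y z)"
  unfolding prepend_tens_def using assms trilinear_map_tens3[of s]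
  by (subst lift2_apply) (auto simp: trilinear_map_def tens3_def)

section \<open>Acting on the first leg of a tensor\<close>

text \<open>Only the values on \<open>U \<times> UNIV\<close> enter the sum over a decomposition
  with first legs in \<open>U\<close>. This permits exchanging linear maps that agree on
  \<open>U\<close> but may differ elsewhere.\<close>

lemma tensor2_eq_on:
  assumes "t = (\<Sum>(x, y)\<leftarrow>ps. tens2 s x y)" and "set ps \<subseteq> U \<times> UNIV"
    and "bilinear_form s v" and "bilinear_form s w"
    and "\<And>x y. x \<in> U \<Longrightarrow> v x y = w x y"
  shows "t v = t w"
  unfolding assms(1) sum_tens2_apply[OF assms(3)] sum_tens2_apply[OF assms(4)]
  using assms(2,5) by (intro arg_cong[where f = sum_list] map_cong) auto

lemma map_first_on_sum:
  assumes s: "vector_space s" and U: "module.subspace s U" and T: "endomorphism_on s U T"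
    and ps: "t = (\<Sum>(x, y)\<leftarrow>ps. tens2 s x y)" "set ps \<subseteq> U \<times> UNIV"
  shows "map_first_on s U T t = (\<Sum>(x, y)\<leftarrow>ps. tens2 s (T x) y)"
  unfolding map_first_on_def ps(1) using bilinear_map_tens2[of s] T ps(2)
  by (intro lift2_on_sum[OF s vector_space_tensor_scale U])
    (auto simp: endomorphism_on_def bilinear_map_def)

text \<open>As \<open>T\<close> is linear on \<open>U\<close> only, \<open>w (T x) y\<close> need
  not be bilinear on \<open>A\<close>, and \<open>t\<close> could send it to the default value
  \<open>0\<close>. A linear extension \<open>T'\<close> repairs this without changing the values on
  the first legs of \<open>t\<close>.\<close>

lemma map_first_on_apply:
  assumes s: "vector_space s" and U: "module.subspace s U" and T: "endomorphism_on s U T"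
    and T': "Vector_Spaces.linear s s T'" "\<And>x. x \<in> U \<Longrightarrow> T' x = T x"
    and ps: "t = (\<Sum>(x, y)\<leftarrow>ps. tens2 s x y)" "set ps \<subseteq> U \<times> UNIV"
    and w: "bilinear_form s w"
  shows "map_first_on s U T t w = t (\<lambda>x y. w (T' x) y)"
proof -
  have w': "bilinear_form s (\<lambda>x y. w (T' x) y)"
    using w T'(1) by (simp add: bilinear_form_iff bilinear_map_def Vector_Spaces.linear_iff)
  have "map_first_on s U T t w = (\<Sum>(x, y)\<leftarrow>map (\<lambda>(x, y). (T x, y)) ps. tens2 s x y) w"
    by (simp add: map_first_on_sum[OF s U T ps] o_def case_prod_unfold)
  also have "\<dots> = (\<Sum>(x, y)\<leftarrow>ps. w (T x) y)"
    unfolding sum_tens2_apply[OF w] by (simp add: o_def case_prod_unfold)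
  also have "\<dots> = (\<Sum>(x, y)\<leftarrow>ps. w (T' x) y)"
    using ps(2) T'(2) by (intro arg_cong[where f = sum_list] map_cong) auto
  finally show ?thesis
    unfolding ps(1) sum_tens2_apply[OF w'] .
qed

text \<open>A linear projection of \<open>A\<close> onto \<open>U\<close>, followed by
  \<open>T\<close>, is linear on all of \<open>A\<close> and agrees with \<open>T\<close> on
  \<open>U\<close>.\<close>

lemma linear_extension:
  assumes s: "vector_space s" and U: "module.subspace s U" and T: "endomorphism_on s U T"
  obtains T' where "Vector_Spaces.linear s s T'" and "\<And>x. x \<in> U \<Longrightarrow> T' x = T x"
proof -
  obtain p where p: "Vector_Spaces.linear s s p" "range p \<subseteq> U" "\<And>x. x \<in> U \<Longrightarrow> p x = x"
    using exists_projection[OF s U] by blast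
  have "p x \<in> U" for x using p(2) by auto
  with p T have "Vector_Spaces.linear s s (T \<circ> p)"
    by (auto simp: Vector_Spaces.linear_iff endomorphism_on_def)
  then show thesis using that[of "T \<circ> p"] p(3) by simp
qed

section \<open>Coproduct and counit evaluated at forms\<close>

context weak_bialgebra
begin

lemma vs: "vector_space scale"
  by unfold_locales

lemma comult_apply_linear:
  "linear_form scale (\<lambda>x. \<Delta> x w)"
  using comult_linear
  by (simp add: linear_form_iff Vector_Spaces.linear_iff tensor_scale_def vs)

lemma bilinear_form_comult_mult:
  assumes w: "bilinear_form scale w"
  shows "bilinear_form scale (\<lambda>a b. \<Delta> y (\<lambda>a' b'. w (a * a') (b * b')))"
proof -
  have "bilinear_form scale (\<lambda>a' b'. w (a * a') (b * b'))" for a b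
    using w by (auto simp: bilinear_form_iff bilinear_map_def distrib_left scale_mult_right)
  with w show ?thesis
    unfolding bilinear_form_def[of _ "\<lambda>a b. \<Delta> y (\<lambda>a' b'. w (a * a') (b * b'))"]
    by (intro conjI allI linear_form_tensor2[OF comult_in_tensor_space vs])
      (auto simp: bilinear_form_def linear_form_iff distrib_right scale_mult_left)
qed

text \<open>The two nested lifts in \<open>mult2\<close> become nested evaluations: the legs of
  \<Delta>(x) and \<Delta>(y) are multiplied inside \<open>w\<close>.\<close>

lemma comult_mult_apply:
  assumes w: "bilinear_form scale w"
  shows "\<Delta> (x * y) w = \<Delta> x (\<lambda>a b. \<Delta> y (\<lambda>a' b'. w (a * a') (b * b')))"
proof -
  let ?g = "\<lambda>a b. lift2 scale (\<lambda>a' b'. tens2 scale (a * a') (b * b')) (\<Delta> y)"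
  have bil: "bilinear_map scale tensor_scale (\<lambda>a' b'. tens2 scale (a * a') (b * b'))" for a b
    using bilinear_map_tens2[of scale]
    by (auto simp: bilinear_map_def distrib_left scale_mult_right)
  have g: "?g a b v = \<Delta> y (\<lambda>a' b'. tens2 scale (a * a') (b * b') v)" for a b v
    by (rule lift2_apply[OF vs comult_in_tensor_space bil])
  \<comment> \<open>Bilinearity of the tensor-valued map \<open>?g\<close> has to hold at every
    argument, so its value away from bilinear forms is needed too.\<close>
  have g': "?g a b v = (if bilinear_form scale v then \<Delta> y (\<lambda>a' b'. v (a * a') (b * b')) else 0)"
    for a b v
  proof (cases "bilinear_form scale v")
    case True
    then show ?thesis unfolding g by (simp add: tens2_def)
  next
    case False
    \<comment> \<open>The zero form is \<open>0\<close> times the bilinear form \<open>w\<close>, to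
      which homogeneity applies.\<close>
    have "\<Delta> y (\<lambda>a b. 0) = 0"
      using tensor2_scale[OF comult_in_tensor_space w, of y 0] by simp
    with False show ?thesis unfolding g by (simp add: tens2_def)
  qed
  have "bilinear_map scale tensor_scale ?g"
    using bilinear_form_comult_mult
    by (intro bilinear_map_tensorI) (auto simp: g' bilinear_form_def linear_form_iff vs)
  from lift2_apply[OF vs comult_in_tensor_space this] w show ?thesis
    unfolding comult_mult mult2_def by (simp add: g')
qed

text \<open>This pairs the left counit law with \<xi>. It is the means of recovering an element from
  its coproduct.\<close>

lemma counit_left_apply:
  assumes "linear_form scale \<xi>"
  shows "\<Delta> x (\<lambda>y z. \<epsilon> y * \<xi> z) = \<xi> x"
proof -
  have "bilinear_map scale scale (\<lambda>y z. scale (\<epsilon> y) z)"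
    using counit_linear by (auto simp: bilinear_map_def linear_form_iff algebra_simps)
  from lift2_eval[OF vs comult_in_tensor_space this assms, of x] assms show ?thesis
    by (simp add: counit_left linear_form_iff)
qed

section \<open>Membership in \<open>A_L\<close> and \<open>A_R\<close>\<close>

lemma A_R_E:
  assumes "a \<in> A_R scale \<Delta>"
  obtains \<phi> where "linear_form scale \<phi>"
    and "\<And>\<xi>. linear_form scale \<xi> \<Longrightarrow> \<xi> a = \<Delta> 1 (\<lambda>x y. \<phi> y * \<xi> x)"
proof -
  obtain \<phi> where \<phi>: "linear_form scale \<phi>" "a = lift2 scale (\<lambda>x y. scale (\<phi> y) x) (\<Delta> 1)"
    using assms by (auto simp: A_R_def)
  have "bilinear_map scale scale (\<lambda>x y. scale (\<phi> y) x)"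
    using \<phi> by (auto simp: bilinear_map_def linear_form_iff algebra_simps)
  note ev = lift2_eval[OF vs comult_in_tensor_space this]
  show thesis
  proof (rule that[OF \<phi>(1)])
    fix \<xi> assume "linear_form scale \<xi>"
    with ev[OF this] show "\<xi> a = \<Delta> 1 (\<lambda>x y. \<phi> y * \<xi> x)"
      by (simp add: \<phi>(2) linear_form_iff)
  qed
qed

lemma A_L_E:
  assumes "a \<in> A_L scale \<Delta>"
  obtains \<phi> where "linear_form scale \<phi>"
    and "\<And>\<xi>. linear_form scale \<xi> \<Longrightarrow> \<xi> a = \<Delta> 1 (\<lambda>x y. \<phi> x * \<xi> y)"
proof -
  obtain \<phi> where \<phi>: "linear_form scale \<phi>" "a = lift2 scale (\<lambda>x y. scale (\<phi> x) y) (\<Delta> 1)"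
    using assms by (auto simp: A_L_def)
  have "bilinear_map scale scale (\<lambda>x y. scale (\<phi> x) y)"
    using \<phi> by (auto simp: bilinear_map_def linear_form_iff algebra_simps)
  note ev = lift2_eval[OF vs comult_in_tensor_space this]
  show thesis
  proof (rule that[OF \<phi>(1)])
    fix \<xi> assume "linear_form scale \<xi>"
    with ev[OF this] show "\<xi> a = \<Delta> 1 (\<lambda>x y. \<phi> x * \<xi> y)"
      by (simp add: \<phi>(2) linear_form_iff)
  qed
qed

text \<open>The values under all linear forms determine \<open>a\<close>, so they force
  \<open>a\<close> to be \<Delta>(1) with \<phi> applied to its second leg.\<close>

lemma A_R_I:
  assumes \<phi>: "linear_form scale \<phi>"
    and a: "\<And>\<xi>. linear_form scale \<xi> \<Longrightarrow> \<xi> a = \<Delta> 1 (\<lambda>x y. \<phi> y * \<xi> x)"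
  shows "a \<in> A_R scale \<Delta>"
proof -
  have b: "bilinear_map scale scale (\<lambda>x y. scale (\<phi> y) x)"
    using \<phi> by (auto simp: bilinear_map_def linear_form_iff algebra_simps)
  have "a = lift2 scale (\<lambda>x y. scale (\<phi> y) x) (\<Delta> 1)"
  proof (rule linear_form_separation[OF vs])
    fix \<xi> assume "linear_form scale \<xi>"
    with a[OF this] lift2_eval[OF vs comult_in_tensor_space b this]
    show "\<xi> a = \<xi> (lift2 scale (\<lambda>x y. scale (\<phi> y) x) (\<Delta> 1))"
      by (simp add: linear_form_iff)
  qed
  with \<phi> show ?thesis by (auto simp: A_R_def)
qed

lemma A_L_I:
  assumes \<phi>: "linear_form scale \<phi>"
    and a: "\<And>\<xi>. linear_form scale \<xi> \<Longrightarrow> \<xi> a = \<Delta> 1 (\<lambda>x y. \<phi> x * \<xi> y)"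
  shows "a \<in> A_L scale \<Delta>"
proof -
  have b: "bilinear_map scale scale (\<lambda>x y. scale (\<phi> x) y)"
    using \<phi> by (auto simp: bilinear_map_def linear_form_iff algebra_simps)
  have "a = lift2 scale (\<lambda>x y. scale (\<phi> x) y) (\<Delta> 1)"
  proof (rule linear_form_separation[OF vs])
    fix \<xi> assume "linear_form scale \<xi>"
    with a[OF this] lift2_eval[OF vs comult_in_tensor_space b this]
    show "\<xi> a = \<xi> (lift2 scale (\<lambda>x y. scale (\<phi> x) y) (\<Delta> 1))"
      by (simp add: linear_form_iff)
  qed
  with \<phi> show ?thesis by (auto simp: A_L_def)
qed

text \<open>The first order of the legs fits \<open>A_L\<close> and the left counit law, the second
  fits \<open>A_R\<close>.\<close>

lemma bilinear_form_mult_forms: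
  assumes "linear_form scale \<phi>" and "linear_form scale \<psi>"
  shows "bilinear_form scale (\<lambda>x y. \<phi> x * \<psi> y)" and "bilinear_form scale (\<lambda>x y. \<phi> y * \<psi> x)"
  using assms by (auto simp: bilinear_form_iff bilinear_map_def linear_form_iff algebra_simps)

text \<open>Applying \<phi> to the second leg of \<Delta>(1) depends linearly on \<phi>, and
  \<open>A_R\<close> is the image of that linear map. Being a subspace is what makes
  \<open>T\<close> on the first leg well defined.\<close>

lemma subspace_A_R: "subspace (A_R scale \<Delta>)"
proof (rule subspaceI)
  show "0 \<in> A_R scale \<Delta>"
  proof (rule A_R_I)
    show l: "linear_form scale (\<lambda>_. 0)" by (simp add: linear_form_iff vs)
    fix \<xi> assume \<xi>: "linear_form scale \<xi>"
    then show "\<xi> 0 = \<Delta> 1 (\<lambda>x y. 0 * \<xi> x)"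
      using tensor2_scale[OF comult_in_tensor_space bilinear_form_mult_forms(2)[OF l \<xi>], of 1 0]
      by (simp add: linear_form_0[OF \<xi>])
  qed
next
  fix a b assume "a \<in> A_R scale \<Delta>" "b \<in> A_R scale \<Delta>"
  obtain \<phi> where \<phi>: "linear_form scale \<phi>"
    "\<And>\<xi>. linear_form scale \<xi> \<Longrightarrow> \<xi> a = \<Delta> 1 (\<lambda>x y. \<phi> y * \<xi> x)"
    using \<open>a \<in> _\<close> by (rule A_R_E) (rule that)
  obtain \<psi> where \<psi>: "linear_form scale \<psi>"
    "\<And>\<xi>. linear_form scale \<xi> \<Longrightarrow> \<xi> b = \<Delta> 1 (\<lambda>x y. \<psi> y * \<xi> x)"
    using \<open>b \<in> _\<close> by (rule A_R_E) (rule that)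
  show "a + b \<in> A_R scale \<Delta>"
  proof (rule A_R_I)
    show "linear_form scale (\<lambda>x. \<phi> x + \<psi> x)"
      using \<phi>(1) \<psi>(1) by (simp add: linear_form_iff algebra_simps)
    fix \<xi> assume \<xi>: "linear_form scale \<xi>"
    then show "\<xi> (a + b) = \<Delta> 1 (\<lambda>x y. (\<phi> y + \<psi> y) * \<xi> x)"
      using tensor2_add[OF comult_in_tensor_space bilinear_form_mult_forms(2)[OF \<phi>(1) \<xi>]
          bilinear_form_mult_forms(2)[OF \<psi>(1) \<xi>], of 1] \<phi>(2)[OF \<xi>] \<psi>(2)[OF \<xi>]
      by (simp add: linear_form_iff distrib_right)
  qed
next
  fix c a assume "a \<in> A_R scale \<Delta>"
  then obtain \<phi> where \<phi>: "linear_form scale \<phi>"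
    "\<And>\<xi>. linear_form scale \<xi> \<Longrightarrow> \<xi> a = \<Delta> 1 (\<lambda>x y. \<phi> y * \<xi> x)"
    by (rule A_R_E) (rule that)
  show "scale c a \<in> A_R scale \<Delta>"
  proof (rule A_R_I)
    show "linear_form scale (\<lambda>x. c * \<phi> x)"
      using \<phi>(1) by (simp add: linear_form_iff algebra_simps)
    fix \<xi> assume \<xi>: "linear_form scale \<xi>"
    then show "\<xi> (scale c a) = \<Delta> 1 (\<lambda>x y. c * \<phi> y * \<xi> x)"
      using tensor2_scale[OF comult_in_tensor_space bilinear_form_mult_forms(2)[OF \<phi>(1) \<xi>], of 1 c]
        \<phi>(2)[OF \<xi>]
      by (simp add: linear_form_iff mult.assoc)
  qed
qed

text \<open>The form \<phi> = \<epsilon> yields \<open>1\<close>, by the right counit law.\<close>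

lemma one_in_A_R: "1 \<in> A_R scale \<Delta>"
proof -
  have "lift2 scale (\<lambda>x y. scale (\<epsilon> y) x) (\<Delta> 1) = 1" by (rule counit_right)
  then show ?thesis using counit_linear unfolding A_R_def by force
qed

text \<open>Expand the second leg of \<open>\<Delta>(1)\<close> in a basis of \<open>A\<close>; the coefficients lie in \<open>A\<^sub>R\<close>.\<close>

lemma comult_one_decomposition:
  obtains ps where "set ps \<subseteq> A_R scale \<Delta> \<times> UNIV" and "\<Delta> 1 = (\<Sum>(x, y)\<leftarrow>ps. tens2 scale x y)"
proof -
  obtain B where B: "finite B" "independent B" "span B = UNIV"
  proof -
    obtain C where "finite C" "span C = UNIV" using finite_dim by blast
    moreover obtain B where "B \<subseteq> C" "independent B" "C \<subseteq> span B"
      by (rule maximal_independent_subset)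
    ultimately show thesis
      using that[of B] finite_subset[of B C] span_minimal[OF _ subspace_span, of C B] by auto
  qed
  let ?r = "\<lambda>b y. representation B y b"
  have r: "linear_form scale (?r b)" for b
    using B by (simp add: linear_form_iff vs representation_add representation_scale)
  have y: "(\<Sum>b\<in>B. scale (?r b y) b) = y" for y
    using B by (intro sum_representation_eq) auto
  \<comment> \<open>\<open>e b\<close> is the coefficient of the basis vector \<open>b\<close> in
    the second leg: the coordinate form \<open>?r b\<close> is applied to that leg of
    \<Delta>(1).\<close>
  define e where "e b = lift2 scale (\<lambda>x y. scale (?r b y) x) (\<Delta> 1)" for b
  have e_bil: "bilinear_map scale scale (\<lambda>x y. scale (?r b y) x)" for b
    using r[of b] by (auto simp: bilinear_map_def linear_form_iff algebra_simps)
  have e: "e b \<in> A_R scale \<Delta>" for b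
    unfolding A_R_def e_def using r[of b] by (intro CollectI exI[of _ "?r b"]) auto
  obtain bs where bs: "set bs = B" "distinct bs"
    using finite_distinct_list[OF B(1)] by blast
  let ?ps = "map (\<lambda>b. (e b, b)) bs"
  have "\<Delta> 1 = (\<Sum>(x, y)\<leftarrow>?ps. tens2 scale x y)"
  proof (rule tensor2_eqI[OF comult_in_tensor_space])
    show "(\<Sum>(x, y)\<leftarrow>?ps. tens2 scale x y) \<in> tensor_space2 scale"
      unfolding tensor_space2_def by blast
    fix w assume w: "bilinear_form scale w"
    then have wl: "linear_form scale (\<lambda>x. w x b)" "linear_form scale (w x)" for b x
      by (auto simp: bilinear_form_def)
    have "w = (\<lambda>x y. \<Sum>b\<in>B. ?r b y * w x b)"
    proof (intro ext)
      fix x y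
      have "w x y = w x (\<Sum>b\<in>B. scale (?r b y) b)" by (simp add: y)
      also have "\<dots> = (\<Sum>b\<in>B. w x (scale (?r b y) b))"
        by (rule linear_form_sum[OF wl(2)])
      finally show "w x y = (\<Sum>b\<in>B. ?r b y * w x b)"
        using wl(2)[of x] by (simp add: linear_form_iff)
    qed
    then have "\<Delta> 1 w = \<Delta> 1 (\<lambda>x y. \<Sum>b\<in>B. ?r b y * w x b)"
      by (rule arg_cong)
    also have "\<dots> = (\<Sum>b\<in>B. \<Delta> 1 (\<lambda>x y. ?r b y * w x b))"
      by (intro tensor2_sum[OF comult_in_tensor_space vs] bilinear_form_mult_forms(2) r wl(1))
    also have "\<dots> = (\<Sum>b\<in>B. w (e b) b)"
    proof (rule sum.cong)
      fix b
      have "w (e b) b = \<Delta> 1 (\<lambda>x y. w (scale (?r b y) x) b)"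
        unfolding e_def by (rule lift2_eval[OF vs comult_in_tensor_space e_bil wl(1)])
      also have "\<dots> = \<Delta> 1 (\<lambda>x y. ?r b y * w x b)"
        using wl(1)[of b] unfolding linear_form_iff by (metis (no_types, lifting))
      finally show "\<Delta> 1 (\<lambda>x y. ?r b y * w x b) = w (e b) b" ..
    qed simp
    also have "\<dots> = (\<Sum>b\<leftarrow>bs. w (e b) b)"
      using bs by (simp add: sum_list_distinct_conv_sum_set)
    finally show "\<Delta> 1 w = (\<Sum>(x, y)\<leftarrow>?ps. tens2 scale x y) w"
      unfolding sum_tens2_apply[OF w] by (simp add: o_def)
  qed
  moreover have "set ?ps \<subseteq> A_R scale \<Delta> \<times> UNIV" using e by auto
  ultimately show thesis using that by blast
qed

lemma bilinear_form_translate: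
  assumes "bilinear_form scale w"
  shows "bilinear_form scale (\<lambda>x y. w x (y * a))" and "bilinear_form scale (\<lambda>x y. w x (a * y))"
    and "bilinear_form scale (\<lambda>x y. w (x * a) y)" and "bilinear_form scale (\<lambda>x y. w (a * x) y)"
  using assms
  by (auto simp: bilinear_form_iff bilinear_map_def algebra_simps scale_mult_left scale_mult_right)

lemma linear_form_translate:
  assumes "linear_form scale \<xi>"
  shows "linear_form scale (\<lambda>x. \<xi> (x * a))" and "linear_form scale (\<lambda>x. \<xi> (a * x))"
  using assms by (auto simp: linear_form_iff algebra_simps scale_mult_left scale_mult_right)


section \<open>Threefold products and coassociativity\<close>

text \<open>The threefold analogue of \<open>comult_mult_apply\<close>, for arbitrary tensors; it
  makes the comonoidality axioms accessible to evaluation.\<close>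

lemma mult3_apply:
  assumes t: "t \<in> tensor_space3 scale" and u: "u \<in> tensor_space3 scale"
    and w: "trilinear_form scale w"
  shows "mult3 scale t u w = t (\<lambda>a b c. u (\<lambda>a' b' c'. w (a * a') (b * b') (c * c')))"
proof -
  let ?g = "\<lambda>a b c. lift3 scale (\<lambda>a' b' c'. tens3 scale (a * a') (b * b') (c * c')) u"
  have tri: "trilinear_map scale tensor_scale (\<lambda>a' b' c'. tens3 scale (a * a') (b * b') (c * c'))"
    for a b c
    using trilinear_map_tens3[of scale]
    by (auto simp: trilinear_map_def bilinear_map_def distrib_left scale_mult_right)
  have g: "?g a b c v = u (\<lambda>a' b' c'. tens3 scale (a * a') (b * b') (c * c') v)" for a b c v
    by (rule lift3_apply[OF vs u tri])
  have g': "?g a b c v =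
      (if trilinear_form scale v then u (\<lambda>a' b' c'. v (a * a') (b * b') (c * c')) else 0)"
    for a b c v
  proof (cases "trilinear_form scale v")
    case True
    then show ?thesis unfolding g by (simp add: tens3_def)
  next
    case False
    have "u (\<lambda>a b c. 0) = 0"
      using tensor3_scale[OF u w, of 0] by simp
    with False show ?thesis unfolding g by (simp add: tens3_def)
  qed
  have tri': "trilinear_form scale (\<lambda>a' b' c'. v (a * a') (b * b') (c * c'))"
    if "trilinear_form scale v" for v a b c
    using that
    by (auto simp: trilinear_form_iff trilinear_map_def bilinear_map_def distrib_left
        scale_mult_right)
  have "trilinear_form scale (\<lambda>a b c. u (\<lambda>a' b' c'. v (a * a') (b * b') (c * c')))"
    if v: "trilinear_form scale v" for v
    unfolding trilinear_form_def using v
    by (intro conjI allI linear_form_tensor3[OF u vs] tri')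
      (auto simp: trilinear_form_def linear_form_iff distrib_right scale_mult_left)
  then have "trilinear_map scale tensor_scale ?g"
    by (intro trilinear_map_tensorI) (auto simp: g' trilinear_form_def linear_form_iff vs)
  from lift3_apply[OF vs t this] w show ?thesis
    unfolding mult3_def by (simp add: g')
qed

lemma trilinear_form_slices:
  assumes "trilinear_form scale w"
  shows "bilinear_form scale (\<lambda>x y. w x y z)" and "bilinear_form scale (w x)"
  using assms by (auto simp: trilinear_form_iff trilinear_map_def bilinear_form_iff)

lemma lift2_append_comult_apply:
  assumes w: "trilinear_form scale w" and t: "t \<in> tensor_space2 scale"
  shows "lift2 scale (\<lambda>y z. append_tens scale (\<Delta> y) z) t w = t (\<lambda>x y. \<Delta> x (\<lambda>a b. w a b y))"
proof -
  \<comment> \<open>As before, the map under the outer lift must be bilinear at every argument,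
    hence the second case: a sum of \<open>tens3\<close> terms vanishes where \<open>v\<close> is
    not trilinear.\<close>
  have *: "append_tens scale (\<Delta> y) z v = (if trilinear_form scale v then \<Delta> y (\<lambda>a b. v a b z) else 0)"
    for y z v
  proof (cases "trilinear_form scale v")
    case False
    obtain ps where "append_tens scale (\<Delta> y) z = (\<Sum>(x, y, z)\<leftarrow>ps. tens3 scale x y z)"
      using append_tens_in_tensor_space3[OF vs comult_in_tensor_space]
      by (auto simp: tensor_space3_def)
    moreover have "(\<Sum>(x, y, z)\<leftarrow>ps. tens3 scale x y z) v = 0"
      by (induction ps) (auto simp: tens3_def False)
    ultimately show ?thesis using False by simp
  qed (simp add: append_tens_apply vs comult_in_tensor_space)
  have "bilinear_form scale (\<lambda>y z. \<Delta> y (\<lambda>a b. v a b z))" if v: "trilinear_form scale v" for v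
    unfolding bilinear_form_def using v
    by (intro conjI allI comult_apply_linear linear_form_tensor2[OF comult_in_tensor_space vs]
        trilinear_form_slices(1)[OF v])
      (auto simp: trilinear_form_def)
  then have "bilinear_map scale tensor_scale (\<lambda>y z. append_tens scale (\<Delta> y) z)"
    by (intro bilinear_map_tensorI) (auto simp: * bilinear_form_def linear_form_iff vs)
  from lift2_apply[OF vs t this] show ?thesis
    by (simp add: * w)
qed

lemma lift2_prepend_comult_apply:
  assumes w: "trilinear_form scale w" and t: "t \<in> tensor_space2 scale"
  shows "lift2 scale (\<lambda>y z. prepend_tens scale y (\<Delta> z)) t w = t (\<lambda>x y. \<Delta> y (\<lambda>a b. w x a b))"
proof -
  have *: "prepend_tens scale y (\<Delta> z) v = (if trilinear_form scale v then \<Delta> z (\<lambda>a b. v y a b) else 0)"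
    for y z v
  proof (cases "trilinear_form scale v")
    case False
    obtain ps where "prepend_tens scale y (\<Delta> z) = (\<Sum>(x, y, z)\<leftarrow>ps. tens3 scale x y z)"
      using prepend_tens_in_tensor_space3[OF vs comult_in_tensor_space]
      by (auto simp: tensor_space3_def)
    moreover have "(\<Sum>(x, y, z)\<leftarrow>ps. tens3 scale x y z) v = 0"
      by (induction ps) (auto simp: tens3_def False)
    ultimately show ?thesis using False by simp
  qed (simp add: prepend_tens_apply vs comult_in_tensor_space)
  have "bilinear_form scale (\<lambda>y z. \<Delta> z (\<lambda>a b. v y a b))" if v: "trilinear_form scale v" for v
    unfolding bilinear_form_def using v
    by (intro conjI allI comult_apply_linear linear_form_tensor2[OF comult_in_tensor_space vs]
        trilinear_form_slices(2)[OF v])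
      (auto simp: trilinear_form_def)
  then have "bilinear_map scale tensor_scale (\<lambda>y z. prepend_tens scale y (\<Delta> z))"
    by (intro bilinear_map_tensorI) (auto simp: * bilinear_form_def linear_form_iff vs)
  from lift2_apply[OF vs t this] show ?thesis
    by (simp add: * w)
qed

text \<open>This moves the second coproduct from one leg to the other inside an evaluation. It is
  needed for \<open>A_L\<close>, where \<phi> occupies the first leg and \<Delta> acts on the
  second.\<close>

lemma coassoc_apply:
  assumes w: "trilinear_form scale w"
  shows "\<Delta> x (\<lambda>y z. \<Delta> y (\<lambda>a b. w a b z)) = \<Delta> x (\<lambda>y z. \<Delta> z (\<lambda>a b. w y a b))"
  using coassoc[of x] lift2_append_comult_apply[OF w comult_in_tensor_space, of x]
    lift2_prepend_comult_apply[OF w comult_in_tensor_space, of x]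
  by simp

end

section \<open>Comonoidality and the coproduct on \<open>A_R\<close> and \<open>A_L\<close>\<close>

context comonoidal_weak_bialgebra
begin

text \<open>In the product of \<Delta>(1) \<otimes> 1 and 1 \<otimes> \<Delta>(1) the outer legs
  meet the factor \<open>1\<close>, so only the middle legs are multiplied.\<close>

lemma comonoidal_left_apply:
  assumes w: "trilinear_form scale w"
  shows "\<Delta> 1 (\<lambda>x y. \<Delta> x (\<lambda>a b. w a b y)) = \<Delta> 1 (\<lambda>x y. \<Delta> 1 (\<lambda>x' y'. w x (y * x') y'))"
proof -
  have w1: "trilinear_form scale (\<lambda>a b c. w (x * a) (y * b) (z * c))" for x y z
    using w by (auto simp: trilinear_form_iff trilinear_map_def bilinear_map_def distrib_left
        scale_mult_right)
  have 1: "prepend_tens scale 1 (\<Delta> 1) (\<lambda>a' b' c'. w (x * a') (y * b') (z * c')) =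
      \<Delta> 1 (\<lambda>b' c'. w x (y * b') (z * c'))" for x y z
    by (simp add: prepend_tens_apply[OF vs comult_in_tensor_space w1])
  have "bilinear_form scale (\<lambda>b' c'. w x (y * b') (z * c'))" for x y z
    using trilinear_form_slices(2)[OF w1, of 1 x y z] by simp
  then have "trilinear_form scale (\<lambda>x y z. \<Delta> 1 (\<lambda>b' c'. w x (y * b') (z * c')))"
    unfolding trilinear_form_def using w
    by (intro conjI allI linear_form_tensor2[OF comult_in_tensor_space vs])
      (auto simp: trilinear_form_def linear_form_iff distrib_right scale_mult_left)
  note 2 = append_tens_apply[OF vs comult_in_tensor_space this, of 1 1]
  show ?thesis
    using mult3_apply[OF append_tens_in_tensor_space3[OF vs comult_in_tensor_space]
        prepend_tens_in_tensor_space3[OF vs comult_in_tensor_space] w, of 1 1 1 1]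
    by (simp add: comonoidal_left lift2_append_comult_apply[OF w comult_in_tensor_space] 1 2)
qed

text \<open>With the factors exchanged the middle legs multiply in the opposite order. This order
  gives the second formula of \<open>comult_A_R\<close>.\<close>

lemma comonoidal_right_apply:
  assumes w: "trilinear_form scale w"
  shows "\<Delta> 1 (\<lambda>x y. \<Delta> x (\<lambda>a b. w a b y)) = \<Delta> 1 (\<lambda>x' y'. \<Delta> 1 (\<lambda>x y. w x (x' * y) y'))"
proof -
  have w1: "trilinear_form scale (\<lambda>a b c. w (x * a) (y * b) (z * c))" for x y z
    using w by (auto simp: trilinear_form_iff trilinear_map_def bilinear_map_def distrib_left
        scale_mult_right)
  have 1: "append_tens scale (\<Delta> 1) 1 (\<lambda>a' b' c'. w (x * a') (y * b') (z * c')) =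
      \<Delta> 1 (\<lambda>a' b'. w (x * a') (y * b') z)" for x y z
    by (simp add: append_tens_apply[OF vs comult_in_tensor_space w1])
  have "bilinear_form scale (\<lambda>a' b'. w (x * a') (y * b') z)" for x y z
    using trilinear_form_slices(1)[OF w1, of x y z 1] by simp
  then have "trilinear_form scale (\<lambda>x y z. \<Delta> 1 (\<lambda>a' b'. w (x * a') (y * b') z))"
    unfolding trilinear_form_def using w
    by (intro conjI allI linear_form_tensor2[OF comult_in_tensor_space vs])
      (auto simp: trilinear_form_def linear_form_iff distrib_right scale_mult_left)
  note 2 = prepend_tens_apply[OF vs comult_in_tensor_space this, of 1 1]
  show ?thesis
    using mult3_apply[OF prepend_tens_in_tensor_space3[OF vs comult_in_tensor_space]
        append_tens_in_tensor_space3[OF vs comult_in_tensor_space] w, of 1 1 1 1]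
    by (simp add: comonoidal_right lift2_append_comult_apply[OF w comult_in_tensor_space] 1 2)
qed

text \<open>Write \<open>a\<close> as \<open>1\<^sub>1\<close> weighted by
  \<phi>(\<open>1\<^sub>2\<close>). Then \<Delta>(a) is the threefold coproduct of \<open>1\<close>
  with \<phi> on the third leg, and in either factorization of it the factor of the middle leg
  paired with \<phi> becomes \<open>a\<close>. The two comonoidality axioms place \<open>a\<close>
  on the right and on the left.\<close>

lemma comult_A_R:
  assumes a: "a \<in> A_R scale \<Delta>" and w: "bilinear_form scale w"
  shows "\<Delta> a w = \<Delta> 1 (\<lambda>x y. w x (y * a))" and "\<Delta> a w = \<Delta> 1 (\<lambda>x y. w x (a * y))"
proof -
  obtain \<phi> where \<phi>: "linear_form scale \<phi>"
    "\<And>\<xi>. linear_form scale \<xi> \<Longrightarrow> \<xi> a = \<Delta> 1 (\<lambda>x y. \<phi> y * \<xi> x)"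
    using a by (rule A_R_E) (rule that)
  have tri: "trilinear_form scale (\<lambda>a b c. \<phi> c * w a b)"
    using \<phi>(1) w
    by (auto simp: trilinear_form_iff trilinear_map_def bilinear_form_iff bilinear_map_def
        linear_form_iff algebra_simps)
  have "\<Delta> a w = \<Delta> 1 (\<lambda>x y. \<phi> y * \<Delta> x w)"
    by (rule \<phi>(2)[OF comult_apply_linear])
  also have "\<dots> = \<Delta> 1 (\<lambda>x y. \<Delta> x (\<lambda>a b. \<phi> y * w a b))"
    by (simp add: tensor2_scale[OF comult_in_tensor_space w])
  finally have eq: "\<Delta> a w = \<Delta> 1 (\<lambda>x y. \<Delta> x (\<lambda>a b. \<phi> y * w a b))" .
  have wl: "linear_form scale (\<lambda>b. w x (y * b))" for x y
    using bilinear_form_translate(2)[OF w] by (simp add: bilinear_form_def)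
  show "\<Delta> a w = \<Delta> 1 (\<lambda>x y. w x (y * a))"
    unfolding eq comonoidal_left_apply[OF tri] \<phi>(2)[OF wl] ..
  \<comment> \<open>Here the outer \<Delta>(1) carries \<phi>, so the whole inner evaluation is the
    linear form to be taken at \<open>a\<close>.\<close>
  have "linear_form scale (\<lambda>b. \<Delta> 1 (\<lambda>x y. w x (b * y)))"
    using bilinear_form_translate(1)[OF w] bilinear_form_translate(2)[OF w]
    by (intro linear_form_tensor2[OF comult_in_tensor_space vs]) (auto simp: bilinear_form_def)
  from \<phi>(2)[OF this]
  show "\<Delta> a w = \<Delta> 1 (\<lambda>x y. w x (a * y))"
    unfolding eq comonoidal_right_apply[OF tri]
    by (simp add: tensor2_scale[OF comult_in_tensor_space bilinear_form_translate(2)[OF w]])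
qed

text \<open>Now \<phi> sits on the first leg and \<Delta> is applied to the second. Coassociativity
  transfers it to the first leg, where comonoidality splits off a factor \<open>1\<^sub>2\<close>
  paired with \<phi>, that is, \<open>a\<close>.\<close>

lemma comult_A_L:
  assumes a: "a \<in> A_L scale \<Delta>" and w: "bilinear_form scale w"
  shows "\<Delta> a w = \<Delta> 1 (\<lambda>x y. w (a * x) y)"
proof -
  obtain \<phi> where \<phi>: "linear_form scale \<phi>"
    "\<And>\<xi>. linear_form scale \<xi> \<Longrightarrow> \<xi> a = \<Delta> 1 (\<lambda>x y. \<phi> x * \<xi> y)"
    using a by (rule A_L_E) (rule that)
  have tri: "trilinear_form scale (\<lambda>a b c. \<phi> a * w b c)"
    using \<phi>(1) w
    by (auto simp: trilinear_form_iff trilinear_map_def bilinear_form_iff bilinear_map_def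
        linear_form_iff algebra_simps)
  have "\<Delta> a w = \<Delta> 1 (\<lambda>x y. \<phi> x * \<Delta> y w)"
    by (rule \<phi>(2)[OF comult_apply_linear])
  also have "\<dots> = \<Delta> 1 (\<lambda>x y. \<Delta> y (\<lambda>a b. \<phi> x * w a b))"
    by (simp add: tensor2_scale[OF comult_in_tensor_space w])
  also have "\<dots> = \<Delta> 1 (\<lambda>x y. \<Delta> x (\<lambda>a b. \<phi> a * w b y))"
    by (rule coassoc_apply[OF tri, symmetric])
  also have "\<dots> = \<Delta> 1 (\<lambda>x y. \<Delta> 1 (\<lambda>x' y'. \<phi> x * w (y * x') y'))"
    by (rule comonoidal_left_apply[OF tri])
  also have "\<dots> = \<Delta> 1 (\<lambda>x y. \<phi> x * \<Delta> 1 (\<lambda>x' y'. w (y * x') y'))"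
    by (simp add: tensor2_scale[OF comult_in_tensor_space bilinear_form_translate(4)[OF w]])
  also have "\<dots> = \<Delta> 1 (\<lambda>x y. w (a * x) y)"
  proof -
    have "linear_form scale (\<lambda>b. \<Delta> 1 (\<lambda>x y. w (b * x) y))"
      using bilinear_form_translate(3)[OF w] bilinear_form_translate(4)[OF w]
      by (intro linear_form_tensor2[OF comult_in_tensor_space vs]) (auto simp: bilinear_form_def)
    from \<phi>(2)[OF this] show ?thesis by simp
  qed
  finally show ?thesis .
qed

text \<open>The first formula of \<open>comult_A_R\<close> leaves the first leg of \<Delta>(1)
  untouched, and those legs can be chosen in \<open>A_R\<close>. Thus \<Delta> maps
  \<open>A_R\<close> into \<open>A_R\<close> \<otimes> \<open>A\<close>, on which \<open>T\<close>
  can act.\<close>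

lemma comult_A_R_decomposition:
  assumes a: "a \<in> A_R scale \<Delta>"
  obtains ps where "set ps \<subseteq> A_R scale \<Delta> \<times> UNIV" and "\<Delta> a = (\<Sum>(x, y)\<leftarrow>ps. tens2 scale x y)"
proof -
  obtain ps where ps: "set ps \<subseteq> A_R scale \<Delta> \<times> UNIV" "\<Delta> 1 = (\<Sum>(x, y)\<leftarrow>ps. tens2 scale x y)"
    by (rule comult_one_decomposition)
  let ?qs = "map (\<lambda>(x, y). (x, y * a)) ps"
  have "\<Delta> a = (\<Sum>(x, y)\<leftarrow>?qs. tens2 scale x y)"
  proof (rule tensor2_eqI[OF comult_in_tensor_space])
    show "(\<Sum>(x, y)\<leftarrow>?qs. tens2 scale x y) \<in> tensor_space2 scale"
      unfolding tensor_space2_def by blast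
    fix w assume w: "bilinear_form scale w"
    show "\<Delta> a w = (\<Sum>(x, y)\<leftarrow>?qs. tens2 scale x y) w"
      unfolding sum_tens2_apply[OF w] comult_A_R(1)[OF a w] ps(2)
        sum_tens2_apply[OF bilinear_form_translate(1)[OF w]]
      by (simp add: o_def case_prod_unfold)
  qed
  moreover have "set ?qs \<subseteq> A_R scale \<Delta> \<times> UNIV" using ps(1) by auto
  ultimately show thesis using that by blast
qed

section \<open>Comodule endomorphisms of \<open>A_R\<close>\<close>

lemma map_first_on_in_tensor_space2:
  assumes T: "endomorphism_on scale (A_R scale \<Delta>) T" and a: "a \<in> A_R scale \<Delta>"
  shows "map_first_on scale (A_R scale \<Delta>) T (\<Delta> a) \<in> tensor_space2 scale"
proof -
  obtain ps where ps: "set ps \<subseteq> A_R scale \<Delta> \<times> UNIV" "\<Delta> a = (\<Sum>(x, y)\<leftarrow>ps. tens2 scale x y)"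
    using a by (rule comult_A_R_decomposition)
  have "map_first_on scale (A_R scale \<Delta>) T (\<Delta> a) = (\<Sum>(x, y)\<leftarrow>ps. tens2 scale (T x) y)"
    using ps T by (intro map_first_on_sum[OF vs subspace_A_R]) auto
  also have "\<dots> = (\<Sum>(x, y)\<leftarrow>map (\<lambda>(x, y). (T x, y)) ps. tens2 scale x y)"
    by (simp add: o_def case_prod_unfold)
  finally show ?thesis unfolding tensor_space2_def by blast
qed

lemma bilinear_form_linear_left:
  assumes "bilinear_form scale w" and "Vector_Spaces.linear scale scale f"
  shows "bilinear_form scale (\<lambda>x y. w (f x) y)"
  using assms by (simp add: bilinear_form_iff bilinear_map_def Vector_Spaces.linear_iff)

text \<open>Both sides are tensors, hence determined by bilinear forms, and there \<open>T\<close>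
  may be replaced by its extension \<open>T'\<close>. Both directions of the theorem work with this
  evaluated condition.\<close>

lemma comodule_endomorphism_iff:
  assumes T: "endomorphism_on scale (A_R scale \<Delta>) T"
    and T': "Vector_Spaces.linear scale scale T'" "\<And>x. x \<in> A_R scale \<Delta> \<Longrightarrow> T' x = T x"
    and a: "a \<in> A_R scale \<Delta>"
  shows "\<Delta> (T a) = map_first_on scale (A_R scale \<Delta>) T (\<Delta> a) \<longleftrightarrow>
    (\<forall>w. bilinear_form scale w \<longrightarrow> \<Delta> (T a) w = \<Delta> a (\<lambda>x y. w (T' x) y))"
proof -
  obtain ps where ps: "set ps \<subseteq> A_R scale \<Delta> \<times> UNIV" "\<Delta> a = (\<Sum>(x, y)\<leftarrow>ps. tens2 scale x y)"
    using a by (rule comult_A_R_decomposition)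
  note map = map_first_on_apply[OF vs subspace_A_R T T' ps(2,1)]
  show ?thesis
    using map tensor2_eqI[OF comult_in_tensor_space map_first_on_in_tensor_space2[OF T a]]
    by metis
qed

text \<open>The comodule condition is used twice, at \<open>a\<close> and at \<open>1\<close>, with
  \<epsilon> \<otimes> \<xi> as the bilinear form throughout. The two formulas of
  \<open>comult_A_R\<close> give the two orders of multiplication.\<close>

lemma comodule_endomorphism_imp:
  assumes T: "endomorphism_on scale (A_R scale \<Delta>) T"
    and T': "Vector_Spaces.linear scale scale T'" "\<And>x. x \<in> A_R scale \<Delta> \<Longrightarrow> T' x = T x"
    and com: "\<And>a w. a \<in> A_R scale \<Delta> \<Longrightarrow> bilinear_form scale w \<Longrightarrow>
      \<Delta> (T a) w = \<Delta> a (\<lambda>x y. w (T' x) y)"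
  shows "T 1 \<in> A_L scale \<Delta> \<inter> A_R scale \<Delta>"
    and "\<And>a. a \<in> A_R scale \<Delta> \<Longrightarrow> T a = T 1 * a" and "\<And>a. a \<in> A_R scale \<Delta> \<Longrightarrow> T a = a * T 1"
proof -
  let ?z = "T 1"
  have z: "?z \<in> A_R scale \<Delta>"
    using T one_in_A_R by (simp add: endomorphism_on_def)
  have eq: "T a = ?z * a" if a: "a \<in> A_R scale \<Delta>" for a
  proof (rule linear_form_separation[OF vs])
    fix \<xi> assume \<xi>: "linear_form scale \<xi>"
    note bil = bilinear_form_mult_forms(1)[OF counit_linear \<xi>]
      bilinear_form_mult_forms(1)[OF counit_linear linear_form_translate(1)[OF \<xi>, of a]]
    have "\<xi> (T a) = \<Delta> (T a) (\<lambda>x y. \<epsilon> x * \<xi> y)"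
      by (rule counit_left_apply[OF \<xi>, symmetric])
    also have "\<dots> = \<Delta> a (\<lambda>x y. \<epsilon> (T' x) * \<xi> y)"
      by (rule com[OF a bil(1)])
    also have "\<dots> = \<Delta> 1 (\<lambda>x y. \<epsilon> (T' x) * \<xi> (y * a))"
      by (rule comult_A_R(1)[OF a bilinear_form_linear_left[OF bil(1) T'(1)]])
    \<comment> \<open>The condition at \<open>1\<close> is read backwards: \<Delta>(1) with
      \<open>T'\<close> on its first leg is \<Delta>(T(1)).\<close>
    also have "\<dots> = \<Delta> ?z (\<lambda>x y. \<epsilon> x * \<xi> (y * a))"
      by (rule com[OF one_in_A_R bil(2), symmetric])
    also have "\<dots> = \<xi> (?z * a)"
      by (rule counit_left_apply[OF linear_form_translate(1)[OF \<xi>]])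
    finally show "\<xi> (T a) = \<xi> (?z * a)" .
  qed
  then show "\<And>a. a \<in> A_R scale \<Delta> \<Longrightarrow> T a = ?z * a" .
  show "T a = a * ?z" if a: "a \<in> A_R scale \<Delta>" for a
  proof (rule linear_form_separation[OF vs])
    fix \<xi> assume \<xi>: "linear_form scale \<xi>"
    note bil = bilinear_form_mult_forms(1)[OF counit_linear \<xi>]
      bilinear_form_mult_forms(1)[OF counit_linear linear_form_translate(2)[OF \<xi>, of a]]
    have "\<xi> (T a) = \<Delta> (T a) (\<lambda>x y. \<epsilon> x * \<xi> y)"
      by (rule counit_left_apply[OF \<xi>, symmetric])
    also have "\<dots> = \<Delta> a (\<lambda>x y. \<epsilon> (T' x) * \<xi> y)"
      by (rule com[OF a bil(1)])
    also have "\<dots> = \<Delta> 1 (\<lambda>x y. \<epsilon> (T' x) * \<xi> (a * y))"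
      by (rule comult_A_R(2)[OF a bilinear_form_linear_left[OF bil(1) T'(1)]])
    also have "\<dots> = \<Delta> ?z (\<lambda>x y. \<epsilon> x * \<xi> (a * y))"
      by (rule com[OF one_in_A_R bil(2), symmetric])
    also have "\<dots> = \<xi> (a * ?z)"
      by (rule counit_left_apply[OF linear_form_translate(2)[OF \<xi>]])
    finally show "\<xi> (T a) = \<xi> (a * ?z)" .
  qed
  have "?z \<in> A_L scale \<Delta>"
  \<comment> \<open>The counit recovers \<open>?z\<close> as
    \<epsilon>(\<open>T' 1\<^sub>1\<close>)\<open>1\<^sub>2\<close>, and \<open>T\<close> is already
    known to be left multiplication by \<open>?z\<close>; this suggests the form.\<close>
  proof (rule A_L_I[where \<phi> = "\<lambda>x. \<epsilon> (?z * x)"])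
    show l: "linear_form scale (\<lambda>x. \<epsilon> (?z * x))"
      by (rule linear_form_translate(2)[OF counit_linear])
    fix \<xi> assume \<xi>: "linear_form scale \<xi>"
    note bil = bilinear_form_mult_forms(1)[OF counit_linear \<xi>]
    obtain ps where ps: "set ps \<subseteq> A_R scale \<Delta> \<times> UNIV" "\<Delta> 1 = (\<Sum>(x, y)\<leftarrow>ps. tens2 scale x y)"
      by (rule comult_one_decomposition)
    have "\<xi> ?z = \<Delta> ?z (\<lambda>x y. \<epsilon> x * \<xi> y)"
      by (rule counit_left_apply[OF \<xi>, symmetric])
    also have "\<dots> = \<Delta> 1 (\<lambda>x y. \<epsilon> (T' x) * \<xi> y)"
      by (rule com[OF one_in_A_R bil])
    \<comment> \<open>\<open>T'\<close> is left multiplication by \<open>?z\<close> on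
      \<open>A_R\<close> only, which suffices because \<Delta>(1) has a decomposition with first
      legs there.\<close>
    also have "\<dots> = \<Delta> 1 (\<lambda>x y. \<epsilon> (?z * x) * \<xi> y)"
      by (rule tensor2_eq_on[OF ps(2,1) bilinear_form_linear_left[OF bil T'(1)]
            bilinear_form_mult_forms(1)[OF l \<xi>]])
        (simp add: T'(2) eq)
    finally show "\<xi> ?z = \<Delta> 1 (\<lambda>x y. \<epsilon> (?z * x) * \<xi> y)" .
  qed
  with z show "?z \<in> A_L scale \<Delta> \<inter> A_R scale \<Delta>" by simp
qed

text \<open>By \<open>comult_A_L\<close>, \<Delta>(z) is \<Delta>(1) with \<open>z\<close>
  multiplied onto the first leg, and multiplicativity absorbs the remaining \<Delta>(1) into
  \<Delta>(a). This gives left multiplication by \<open>z\<close> on the first leg of \<Delta>(a),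
  where it can be replaced by \<open>T'\<close>.\<close>

lemma comodule_endomorphism_if:
  assumes z: "z \<in> A_L scale \<Delta>" and a: "a \<in> A_R scale \<Delta>"
    and T': "Vector_Spaces.linear scale scale T'" "\<And>x. x \<in> A_R scale \<Delta> \<Longrightarrow> T' x = z * x"
    and w: "bilinear_form scale w"
  shows "\<Delta> (z * a) w = \<Delta> a (\<lambda>x y. w (T' x) y)"
proof -
  obtain ps where ps: "set ps \<subseteq> A_R scale \<Delta> \<times> UNIV" "\<Delta> a = (\<Sum>(x, y)\<leftarrow>ps. tens2 scale x y)"
    using a by (rule comult_A_R_decomposition)
  have "\<Delta> (z * a) w = \<Delta> z (\<lambda>x y. \<Delta> a (\<lambda>x' y'. w (x * x') (y * y')))"
    by (rule comult_mult_apply[OF w])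
  also have "\<dots> = \<Delta> 1 (\<lambda>x y. \<Delta> a (\<lambda>x' y'. w (z * x * x') (y * y')))"
    by (rule comult_A_L[OF z bilinear_form_comult_mult[OF w]])
  \<comment> \<open>Writing \<open>a\<close> as \<open>1 * a\<close> is what absorbs \<Delta>(1),
    which in general differs from 1 \<otimes> 1.\<close>
  also have "\<dots> = \<Delta> (1 * a) (\<lambda>x y. w (z * x) y)"
    by (simp only: comult_mult_apply[OF bilinear_form_translate(4)[OF w]] mult.assoc)
  also have "\<dots> = \<Delta> a (\<lambda>x y. w (z * x) y)"
    by simp
  also have "\<dots> = \<Delta> a (\<lambda>x y. w (T' x) y)"
    by (rule tensor2_eq_on[OF ps(2,1) bilinear_form_translate(4)[OF w]
          bilinear_form_linear_left[OF w T'(1)]]) (simp add: T'(2))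
  finally show ?thesis .
qed

end

theorem lemma4p5:
  fixes scale :: "'k::field \<Rightarrow> 'a::{ring, monoid_mult} \<Rightarrow> 'a"
    and \<Delta> :: "'a \<Rightarrow> ('k, 'a) tensor2"
    and \<epsilon> :: "'a \<Rightarrow> 'k"
    and T :: "'a \<Rightarrow> 'a"
  assumes "comonoidal_weak_bialgebra scale \<Delta> \<epsilon>"
    and "endomorphism_on scale (A_R scale \<Delta>) T"
  shows "(\<forall>a\<in>A_R scale \<Delta>. \<Delta> (T a) = map_first_on scale (A_R scale \<Delta>) T (\<Delta> a)) \<longleftrightarrow>
         (\<exists>z\<in>A_L scale \<Delta> \<inter> A_R scale \<Delta>. \<forall>a\<in>A_R scale \<Delta>. T a = a * z \<and> T a = z * a)"
proof -
  interpret comonoidal_weak_bialgebra scale \<Delta> \<epsilon> by (rule assms(1))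
  \<comment> \<open>Any linear extension will do: it keeps the forms bilinear on all of
    \<open>A\<close>, and only its values on \<open>A_R\<close> influence the result.\<close>
  obtain T' where T': "Vector_Spaces.linear scale scale T'"
    "\<And>x. x \<in> A_R scale \<Delta> \<Longrightarrow> T' x = T x"
    by (rule linear_extension[OF vs subspace_A_R assms(2)]) blast
  have iff: "\<Delta> (T a) = map_first_on scale (A_R scale \<Delta>) T (\<Delta> a) \<longleftrightarrow>
      (\<forall>w. bilinear_form scale w \<longrightarrow> \<Delta> (T a) w = \<Delta> a (\<lambda>x y. w (T' x) y))"
    if "a \<in> A_R scale \<Delta>" for a
    by (rule comodule_endomorphism_iff[OF assms(2) T' that])
  show ?thesis
  proof
    assume "\<forall>a\<in>A_R scale \<Delta>. \<Delta> (T a) = map_first_on scale (A_R scale \<Delta>) T (\<Delta> a)"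
    then have com: "\<Delta> (T a) w = \<Delta> a (\<lambda>x y. w (T' x) y)"
      if "a \<in> A_R scale \<Delta>" "bilinear_form scale w" for a w
      using iff that by blast
    note imp = comodule_endomorphism_imp[OF assms(2) T' com]
    show "\<exists>z\<in>A_L scale \<Delta> \<inter> A_R scale \<Delta>. \<forall>a\<in>A_R scale \<Delta>. T a = a * z \<and> T a = z * a"
      by (intro bexI[of _ "T 1"] ballI conjI imp)
  next
    assume "\<exists>z\<in>A_L scale \<Delta> \<inter> A_R scale \<Delta>. \<forall>a\<in>A_R scale \<Delta>. T a = a * z \<and> T a = z * a"
    then obtain z where z: "z \<in> A_L scale \<Delta>" "\<And>a. a \<in> A_R scale \<Delta> \<Longrightarrow> T a = z * a" by blast
    show "\<forall>a\<in>A_R scale \<Delta>. \<Delta> (T a) = map_first_on scale (A_R scale \<Delta>) T (\<Delta> a)"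
    proof
      fix a assume a: "a \<in> A_R scale \<Delta>"
      have "\<Delta> (T a) w = \<Delta> a (\<lambda>x y. w (T' x) y)" if "bilinear_form scale w" for w
        unfolding z(2)[OF a] using T'(2) z(2)
        by (intro comodule_endomorphism_if[OF z(1) a T'(1) _ that]) simp
      then show "\<Delta> (T a) = map_first_on scale (A_R scale \<Delta>) T (\<Delta> a)"
        using iff[OF a] by blast
    qed
  qed
qed

end
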